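(* Let $(\mathcal N,g,\phi)$ be a complete $\phi$-parabolic manifold with density and $dm=e^\phi\,dv$. Then every critical transportation plan $\mu$ for the Boltzmann entropy functional is of the form $\mu=\alpha\,dm$ with $\alpha\in\mathbb R^+$. Moreover, if one assumes $\int_{\mathcal N}d\mu=\int_{\mathcal N}dm$, then the only optimal transportation plan is $\mu=e^\phi\,dv$.
   Context: Manifolds are smooth, connected, orientable and without boundary, and all objects are assumed smooth. A manifold with density $(\mathcal N,g,\phi)$ is a Riemannian manifold $(\mathcal N,g)$, with Riemannian measure $dv$ and distance $d$, together with $\phi\in C^\infty(\mathcal N)$. It is $\phi$-parabolic if every function $u\ge 0$ on $\mathcal N$ with $\Delta u+g(\nabla\phi,\nabla u)\le 0$ is constant. The Boltzmann entropy functional is $\mathcal H_m(\mu)=\int_{\mathcal N}\rho\ln\rho\,dm$ for $\mu=\rho\,dm$ in the Wasserstein space $\mathcal P_2(\mathcal N)$ of probability measures $\mu$ with $\int_{\mathcal N}d(p_0,p)^2\,d\mu<+\infty$ ($p_0\in\mathcal N$ arbitrary). Its (Otto) gradient at $\mu=\rho\,dm$ is $-(\Delta\rho+g(\nabla\phi,\nabla\rho))\,dm$. A critical transportation plan for $\mathcal H_m$ is a critical point of $\mathcal H_m$, i.e. a measure $\mu=\rho\,dm$ with $\rho$ a positive smooth function satisfying $\Delta\rho+g(\nabla\phi,\nabla\rho)=0$ on $\mathcal N$. Optimal transportation plans (for the Boltzmann entropy functional) are in particular critical transportation plans; "the only optimal transportation plan is $e^\phi\,dv$" means that any optimal transportation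 plan satisfying the normalization equals $e^\phi\,dv$. *)

theory Defs
  imports "HOL-Analysis.Analysis" "HOL-Probability.Probability_Measure"
begin

section \<open>Smooth functions between normed spaces\<close>

text \<open>The set \<open>S\<close> is always open below, so \<open>at x\<close> is the right filter.\<close>

primrec k_times_differentiable_on ::
  "nat \<Rightarrow> 'a::real_normed_vector set \<Rightarrow> ('a \<Rightarrow> 'b::real_normed_vector) \<Rightarrow> bool" where
  "k_times_differentiable_on 0 S f \<longleftrightarrow> continuous_on S f"
| "k_times_differentiable_on (Suc k) S f \<longleftrightarrow>
     (\<forall>x\<in>S. f differentiable (at x)) \<and>
     (\<forall>v. k_times_differentiable_on k S (\<lambda>x. frechet_derivative f (at x) v))"

definition smooth_on :: "'a::real_normed_vector set \<Rightarrow> ('a \<Rightarrow> 'b::real_normed_vector) \<Rightarrow> bool" where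
  "smooth_on S f \<longleftrightarrow> (\<forall>k. k_times_differentiable_on k S f)"

definition partial :: "'n \<Rightarrow> (real^'n \<Rightarrow> real) \<Rightarrow> real^'n \<Rightarrow> real" where
  "partial i f x = frechet_derivative f (at x) (axis i 1)"

section \<open>Smooth manifolds\<close>

text \<open>The points of the manifold are all elements of a Hausdorff second countable type \<open>'a\<close>.
  A chart is a pair of a domain and a coordinate map, whose values off the domain are irrelevant.
  The dimension is \<open>CARD('n) \<ge> 1\<close>.\<close>

type_synonym ('a, 'n) chart = "'a set \<times> ('a \<Rightarrow> real^'n)"

abbreviation cdom :: "('a, 'n) chart \<Rightarrow> 'a set" where "cdom c \<equiv> fst c"
abbreviation coord :: "('a, 'n) chart \<Rightarrow> 'a \<Rightarrow> real^'n" where "coord c \<equiv> snd c"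
abbreviation cimage :: "('a, 'n) chart \<Rightarrow> (real^'n) set" where "cimage c \<equiv> coord c ` cdom c"
abbreviation param :: "('a, 'n) chart \<Rightarrow> real^'n \<Rightarrow> 'a" where
  "param c \<equiv> inv_into (cdom c) (coord c)"

definition is_chart :: "('a::topological_space, 'n::finite) chart \<Rightarrow> bool" where
  "is_chart c \<longleftrightarrow> open (cdom c) \<and> open (cimage c) \<and>
     homeomorphism (cdom c) (cimage c) (coord c) (param c)"

definition smooth_atlas :: "('a::topological_space, 'n::finite) chart set \<Rightarrow> bool" where
  "smooth_atlas A \<longleftrightarrow> (\<forall>c\<in>A. is_chart c) \<and> (\<Union>c\<in>A. cdom c) = UNIV \<and>
     (\<forall>c\<in>A. \<forall>c'\<in>A. smooth_on (coord c ` (cdom c \<inter> cdom c')) (coord c' \<circ> param c))"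

definition transition_jacobian ::
  "('a, 'n::finite) chart \<Rightarrow> ('a, 'n) chart \<Rightarrow> 'a \<Rightarrow> real^'n^'n" where
  "transition_jacobian c c' p =
     matrix (frechet_derivative (coord c' \<circ> param c) (at (coord c p)))"

definition orientable :: "('a::topological_space, 'n::finite) chart set \<Rightarrow> bool" where
  "orientable A \<longleftrightarrow> (\<exists>B. smooth_atlas B \<and> smooth_atlas (A \<union> B) \<and>
     (\<forall>c\<in>B. \<forall>c'\<in>B. \<forall>p\<in>cdom c \<inter> cdom c'. det (transition_jacobian c c' p) > 0))"

definition smooth_fun :: "('a, 'n::finite) chart set \<Rightarrow> ('a \<Rightarrow> real) \<Rightarrow> bool" where
  "smooth_fun A u \<longleftrightarrow> (\<forall>c\<in>A. smooth_on (cimage c) (u \<circ> param c))"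

section \<open>Riemannian metrics\<close>

text \<open>A metric is given by its matrix of components \<open>G c p\<close> in each chart \<open>c\<close> at each point \<open>p\<close> of
  its domain; the last clause is the transformation law of a covariant 2-tensor.\<close>

type_synonym ('a, 'n) metric_field = "('a, 'n) chart \<Rightarrow> 'a \<Rightarrow> real^'n^'n"

definition riemannian_metric ::
  "('a, 'n::finite) chart set \<Rightarrow> ('a, 'n) metric_field \<Rightarrow> bool" where
  "riemannian_metric A G \<longleftrightarrow>
     (\<forall>c\<in>A. (\<forall>i j. smooth_on (cimage c) (\<lambda>x. G c (param c x) $ i $ j)) \<and>
        (\<forall>p\<in>cdom c. transpose (G c p) = G c p \<and> (\<forall>v. v \<noteq> 0 \<longrightarrow> v \<bullet> (G c p *v v) > 0))) \<and>
     (\<forall>c\<in>A. \<forall>c'\<in>A. \<forall>p\<in>cdom c \<inter> cdom c'.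
        G c p = transpose (transition_jacobian c c' p) ** G c' p ** transition_jacobian c c' p)"

definition riemannian_manifold ::
  "('a::{t2_space, second_countable_topology}, 'n::finite) chart set \<Rightarrow> ('a, 'n) metric_field \<Rightarrow> bool"
  where
  "riemannian_manifold A G \<longleftrightarrow>
     smooth_atlas A \<and> orientable A \<and> connected (UNIV :: 'a set) \<and> riemannian_metric A G"

text \<open>The quantities computed below in the chart \<open>chart_at A p\<close> do not depend on the
  choice of a chart around \<open>p\<close>.\<close>

definition chart_at :: "('a, 'n) chart set \<Rightarrow> 'a \<Rightarrow> ('a, 'n) chart" where
  "chart_at A p = (SOME c. c \<in> A \<and> p \<in> cdom c)"

definition metric_inner ::
  "('a, 'n::finite) metric_field \<Rightarrow> ('a, 'n) chart \<Rightarrow> 'a \<Rightarrow> real^'n \<Rightarrow> real^'n \<Rightarrow> real" where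
  "metric_inner G c p v w = v \<bullet> (G c p *v w)"

text \<open>Components \<open>\<Sum>\<^sub>j g\<^sup>i\<^sup>j \<partial>\<^sub>j u\<close> of the gradient of \<open>u\<close> in the chart \<open>c\<close>.\<close>

definition grad_in ::
  "('a, 'n::finite) metric_field \<Rightarrow> ('a, 'n) chart \<Rightarrow> ('a \<Rightarrow> real) \<Rightarrow> 'a \<Rightarrow> real^'n" where
  "grad_in G c u p = matrix_inv (G c p) *v (\<chi> j. partial j (u \<circ> param c) (coord c p))"

definition volume_factor :: "('a, 'n::finite) metric_field \<Rightarrow> ('a, 'n) chart \<Rightarrow> 'a \<Rightarrow> real" where
  "volume_factor G c p = sqrt (det (G c p))"

definition div_in ::
  "('a, 'n::finite) metric_field \<Rightarrow> ('a, 'n) chart \<Rightarrow> ('a \<Rightarrow> real^'n) \<Rightarrow> 'a \<Rightarrow> real" where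
  "div_in G c X p = (\<Sum>i\<in>UNIV.
     partial i (\<lambda>x. volume_factor G c (param c x) * X (param c x) $ i) (coord c p))
     / volume_factor G c p"

definition grad_inner ::
  "('a, 'n::finite) chart set \<Rightarrow> ('a, 'n) metric_field \<Rightarrow> ('a \<Rightarrow> real) \<Rightarrow> ('a \<Rightarrow> real) \<Rightarrow> 'a \<Rightarrow> real"
  where
  "grad_inner A G u w p = (let c = chart_at A p in
     metric_inner G c p (grad_in G c u p) (grad_in G c w p))"

definition laplacian ::
  "('a, 'n::finite) chart set \<Rightarrow> ('a, 'n) metric_field \<Rightarrow> ('a \<Rightarrow> real) \<Rightarrow> 'a \<Rightarrow> real" where
  "laplacian A G u p = (let c = chart_at A p in div_in G c (grad_in G c u) p)"

section \<open>Riemannian measure, distance and completeness\<close>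

definition chart_volume ::
  "('a, 'n::finite) metric_field \<Rightarrow> ('a, 'n) chart \<Rightarrow> 'a set \<Rightarrow> ennreal" where
  "chart_volume G c P =
     (\<integral>\<^sup>+x\<in>coord c ` P. ennreal (volume_factor G c (param c x)) \<partial>lborel)"

text \<open>The volume of a Borel set is the sum of the chart volumes of the pieces of any
  countable Borel partition subordinate to the atlas; it is independent of the partition.\<close>

definition riemannian_measure ::
  "('a::topological_space, 'n::finite) chart set \<Rightarrow> ('a, 'n) metric_field \<Rightarrow> 'a measure" where
  "riemannian_measure A G = measure_of UNIV (sets borel) (\<lambda>B. THE s.
     \<exists>(c :: nat \<Rightarrow> ('a, 'n) chart) P.
       (\<forall>k. c k \<in> A \<and> P k \<in> sets borel \<and> P k \<subseteq> cdom (c k)) \<and>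
       disjoint_family P \<and> (\<Union>k. P k) = B \<and> s = (\<Sum>k. chart_volume G (c k) (P k)))"

definition pw_C1_curve ::
  "('a::topological_space, 'n::finite) chart set \<Rightarrow> (real \<Rightarrow> 'a) \<Rightarrow> bool" where
  "pw_C1_curve A \<gamma> \<longleftrightarrow> continuous_on {0..1} \<gamma> \<and>
     (\<forall>c\<in>A. \<forall>a b. {a..b} \<subseteq> {0..1} \<and> \<gamma> ` {a..b} \<subseteq> cdom c \<longrightarrow>
        (coord c \<circ> \<gamma>) piecewise_C1_differentiable_on {a..b})"

definition curve_length ::
  "('a, 'n::finite) chart set \<Rightarrow> ('a, 'n) metric_field \<Rightarrow> (real \<Rightarrow> 'a) \<Rightarrow> ennreal" where
  "curve_length A G \<gamma> = (\<integral>\<^sup>+t\<in>{0..1}. ennreal (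
     let c = chart_at A (\<gamma> t); v = vector_derivative (coord c \<circ> \<gamma>) (at t)
     in sqrt (metric_inner G c (\<gamma> t) v v)) \<partial>lborel)"

definition riemannian_dist ::
  "('a::topological_space, 'n::finite) chart set \<Rightarrow> ('a, 'n) metric_field \<Rightarrow> 'a \<Rightarrow> 'a \<Rightarrow> real" where
  "riemannian_dist A G p q =
     enn2real (INF \<gamma>\<in>{\<gamma>. pw_C1_curve A \<gamma> \<and> \<gamma> 0 = p \<and> \<gamma> 1 = q}. curve_length A G \<gamma>)"

definition complete_manifold ::
  "('a::topological_space, 'n::finite) chart set \<Rightarrow> ('a, 'n) metric_field \<Rightarrow> bool" where
  "complete_manifold A G \<longleftrightarrow> Metric_space.mcomplete UNIV (riemannian_dist A G)"

section \<open>Manifolds with density\<close>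

definition manifold_with_density ::
  "('a::{t2_space, second_countable_topology}, 'n::finite) chart set \<Rightarrow> ('a, 'n) metric_field \<Rightarrow>
    ('a \<Rightarrow> real) \<Rightarrow> bool" where
  "manifold_with_density A G \<phi> \<longleftrightarrow> riemannian_manifold A G \<and> smooth_fun A \<phi>"

definition weighted_measure ::
  "('a::topological_space, 'n::finite) chart set \<Rightarrow> ('a, 'n) metric_field \<Rightarrow> ('a \<Rightarrow> real) \<Rightarrow> 'a measure"
  where
  "weighted_measure A G \<phi> = density (riemannian_measure A G) (\<lambda>p. ennreal (exp (\<phi> p)))"

definition phi_laplacian ::
  "('a, 'n::finite) chart set \<Rightarrow> ('a, 'n) metric_field \<Rightarrow> ('a \<Rightarrow> real) \<Rightarrow> ('a \<Rightarrow> real) \<Rightarrow> 'a \<Rightarrow> real"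
  where
  "phi_laplacian A G \<phi> u p = laplacian A G u p + grad_inner A G \<phi> u p"

definition phi_parabolic ::
  "('a, 'n::finite) chart set \<Rightarrow> ('a, 'n) metric_field \<Rightarrow> ('a \<Rightarrow> real) \<Rightarrow> bool" where
  "phi_parabolic A G \<phi> \<longleftrightarrow>
     (\<forall>u. smooth_fun A u \<and> (\<forall>p. 0 \<le> u p) \<and> (\<forall>p. phi_laplacian A G \<phi> u p \<le> 0) \<longrightarrow>
        (\<exists>k. \<forall>p. u p = k))"

section \<open>Boltzmann entropy and transportation plans\<close>

definition wasserstein_space ::
  "('a::topological_space, 'n::finite) chart set \<Rightarrow> ('a, 'n) metric_field \<Rightarrow> 'a measure set" where
  "wasserstein_space A G = {\<mu>. sets \<mu> = sets borel \<and> prob_space \<mu> \<and>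
     (\<forall>p\<^sub>0. (\<integral>\<^sup>+p. ennreal ((riemannian_dist A G p\<^sub>0 p)\<^sup>2) \<partial>\<mu>) < \<infinity>)}"

text \<open>The integral of \<open>\<rho> ln \<rho>\<close> is taken as the difference of the integrals of the positive and
  negative parts. The usual conventions apply: \<open>0 ln 0 = 0\<close>, and the
  value is \<open>\<infinity>\<close> if \<open>\<mu>\<close> has no density or if both parts have infinite integral
  (in \<open>ereal\<close>, \<open>\<infinity> - \<infinity> = \<infinity>\<close>).\<close>

definition boltzmann_entropy :: "'a measure \<Rightarrow> 'a measure \<Rightarrow> ereal" where
  "boltzmann_entropy m \<mu> =
     (if \<exists>\<rho>\<in>borel_measurable m. \<mu> = density m \<rho> then
        let \<rho> = (\<lambda>p. enn2real (RN_deriv m \<mu> p)) in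
          enn2ereal (\<integral>\<^sup>+p. ennreal (\<rho> p * ln (\<rho> p)) \<partial>m) -
          enn2ereal (\<integral>\<^sup>+p. ennreal (- (\<rho> p * ln (\<rho> p))) \<partial>m)
      else \<infinity>)"

text \<open>Vanishing of the Otto gradient \<open>-(\<Delta>\<rho> + g(\<nabla>\<phi>,\<nabla>\<rho>)) dm\<close> of the entropy at \<open>\<mu> = \<rho> dm\<close>.
  The total mass of \<open>\<mu>\<close> is deliberately left unrestricted.\<close>

definition critical_plan ::
  "('a::topological_space, 'n::finite) chart set \<Rightarrow> ('a, 'n) metric_field \<Rightarrow> ('a \<Rightarrow> real) \<Rightarrow>
    'a measure \<Rightarrow> bool" where
  "critical_plan A G \<phi> \<mu> \<longleftrightarrow> (\<exists>\<rho>. smooth_fun A \<rho> \<and> (\<forall>p. 0 < \<rho> p) \<and>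
     \<mu> = density (weighted_measure A G \<phi>) (\<lambda>p. ennreal (\<rho> p)) \<and>
     (\<forall>p. phi_laplacian A G \<phi> \<rho> p = 0))"

text \<open>Optimal plans are the measures of finite entropy with smooth positive density that minimize the
  entropy on the Wasserstein space. Criticality is a consequence and not part of the
  definition; it would fail for minimizers of entropy \<open>-\<infinity>\<close>.\<close>

definition optimal_plan ::
  "('a::topological_space, 'n::finite) chart set \<Rightarrow> ('a, 'n) metric_field \<Rightarrow> ('a \<Rightarrow> real) \<Rightarrow>
    'a measure \<Rightarrow> bool" where
  "optimal_plan A G \<phi> \<mu> \<longleftrightarrow> \<mu> \<in> wasserstein_space A G \<and>
     (\<exists>\<rho>. smooth_fun A \<rho> \<and> (\<forall>p. 0 < \<rho> p) \<and>
        \<mu> = density (weighted_measure A G \<phi>) (\<lambda>p. ennreal (\<rho> p))) \<and>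
     \<bar>boltzmann_entropy (weighted_measure A G \<phi>) \<mu>\<bar> \<noteq> \<infinity> \<and>
     (\<forall>\<nu>\<in>wasserstein_space A G. boltzmann_entropy (weighted_measure A G \<phi>) \<mu>
        \<le> boltzmann_entropy (weighted_measure A G \<phi>) \<nu>)"

end

theory Submission
  imports Defs
begin

text \<open>A positive solution of the critical equation is a nonnegative \<open>\<phi>\<close>-superharmonic function,
  so it is constant by parabolicity. For the uniqueness of the optimal plan, the normalization makes
  \<open>m\<close> a probability measure, and \<open>ln x \<le> x - 1\<close> gives \<open>H(\<rho> m) \<ge> 0\<close> with equality only for
  \<open>\<rho> = 1\<close>. Since \<open>m\<close> may have infinite second moment, it need not itself be a competitor.
  Instead, the normalized restriction of \<open>m\<close> to \<open>{\<rho> \<ge> 1/(n+1)}\<close> has a bounded density with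
  respect to the optimal \<open>\<mu> = \<rho> m\<close>, hence a finite second moment, and its entropy is
  \<open>- ln m{\<rho> \<ge> 1/(n+1)}\<close>, which tends to \<open>0\<close>.\<close>

section \<open>Continuity of smooth functions and integrals against bounded densities\<close>

lemma smooth_fun_continuous:
  assumes "smooth_atlas A" "smooth_fun A u"
  shows "continuous_on UNIV u"
proof -
  have "continuous_on (cdom c) u" if c: "c \<in> A" for c
  proof -
    have hom: "homeomorphism (cdom c) (cimage c) (coord c) (param c)"
      using assms(1) c by (auto simp: smooth_atlas_def is_chart_def)
    have "smooth_on (cimage c) (u \<circ> param c)"
      using assms(2) c by (auto simp: smooth_fun_def)
    then have "k_times_differentiable_on 0 (cimage c) (u \<circ> param c)"
      unfolding smooth_on_def by blast
    then have "continuous_on (cimage c) (u \<circ> param c)"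
      by simp
    then have "continuous_on (cdom c) ((u \<circ> param c) \<circ> coord c)"
      using hom by (auto simp only: homeomorphism_def intro: continuous_on_compose[of "cdom c" "coord c" "u \<circ> param c"])
    then show ?thesis
      by (rule continuous_on_eq) (use hom in \<open>simp add: homeomorphism_def\<close>)
  qed
  moreover have "\<And>c. c \<in> A \<Longrightarrow> open (cdom c)" "(\<Union>c\<in>A. cdom c) = UNIV"
    using assms(1) by (auto simp: smooth_atlas_def is_chart_def)
  ultimately show ?thesis
    by (metis continuous_on_open_UN)
qed

text \<open>Measurability of \<open>g\<close> is not assumed, so the squared Riemannian distance can
  be inserted later without a proof that it is measurable. The integral is a supremum over simple
  functions below \<open>g\<close>, and the density formula applies to each of those.\<close>

lemma nn_integral_density_le:
  fixes g :: "'a \<Rightarrow> ennreal"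
  assumes [measurable]: "f \<in> borel_measurable M"
    and bound: "\<And>x. x \<in> space M \<Longrightarrow> f x \<le> C"
  shows "(\<integral>\<^sup>+x. g x \<partial>density M f) \<le> C * (\<integral>\<^sup>+x. g x \<partial>M)"
  unfolding nn_integral_def[of "density M f"]
proof (rule SUP_least)
  fix s :: "'a \<Rightarrow> ennreal" assume "s \<in> {s. simple_function (density M f) s \<and> s \<le> g}"
  then have s: "simple_function (density M f) s" "s \<le> g"
    by auto
  \<comment> \<open>Simplicity depends only on the space and the measurable sets, which
    \<open>density\<close> leaves unchanged.\<close>
  then have sM: "simple_function M s"
    by (simp add: simple_function_def)
  then have [measurable]: "s \<in> borel_measurable M"
    by (rule borel_measurable_simple_function)
  have "integral\<^sup>S (density M f) s = (\<integral>\<^sup>+x. s x \<partial>density M f)"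
    using s(1) by (simp add: nn_integral_eq_simple_integral)
  also have "\<dots> = (\<integral>\<^sup>+x. f x * s x \<partial>M)"
    by (simp add: nn_integral_density)
  also have "\<dots> \<le> (\<integral>\<^sup>+x. C * s x \<partial>M)"
    by (intro nn_integral_mono mult_right_mono bound) auto
  also have "\<dots> = C * (\<integral>\<^sup>+x. s x \<partial>M)"
    by (simp add: nn_integral_cmult)
  also have "\<dots> \<le> C * (\<integral>\<^sup>+x. g x \<partial>M)"
    using s(2) by (intro mult_left_mono nn_integral_mono) (auto simp: le_fun_def)
  finally show "integral\<^sup>S (density M f) s \<le> C * (\<integral>\<^sup>+x. g x \<partial>M)" .
qed

section \<open>Entropy on abstract measure spaces\<close>

lemma boltzmann_entropy_density:
  assumes "sigma_finite_measure m"
    and [measurable]: "g \<in> borel_measurable m"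
    and nonneg: "\<And>x. x \<in> space m \<Longrightarrow> 0 \<le> (g x :: real)"
  shows "boltzmann_entropy m (density m (\<lambda>x. ennreal (g x))) =
    enn2ereal (\<integral>\<^sup>+x. ennreal (g x * ln (g x)) \<partial>m) -
    enn2ereal (\<integral>\<^sup>+x. ennreal (- (g x * ln (g x))) \<partial>m)"
proof -
  interpret sigma_finite_measure m by fact
  let ?\<mu> = "density m (\<lambda>x. ennreal (g x))"
  \<comment> \<open>The entropy is defined through the chosen derivative \<open>RN_deriv\<close>;
    sigma-finiteness makes it agree almost everywhere with the given density.\<close>
  have "AE x in m. ennreal (g x) = RN_deriv m ?\<mu> x"
    by (rule RN_deriv_unique) auto
  then have ae: "AE x in m. enn2real (RN_deriv m ?\<mu> x) = g x"
    using AE_space by eventually_elim (metis enn2real_ennreal nonneg)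
  have "(\<lambda>x. ennreal (g x)) \<in> borel_measurable m"
    by simp
  then have ex: "\<exists>\<rho>\<in>borel_measurable m. ?\<mu> = density m \<rho>"
    by blast
  let ?h = "\<lambda>x. enn2real (RN_deriv m ?\<mu> x)"
  have "(\<integral>\<^sup>+x. ennreal (?h x * ln (?h x)) \<partial>m) = (\<integral>\<^sup>+x. ennreal (g x * ln (g x)) \<partial>m)"
    "(\<integral>\<^sup>+x. ennreal (- (?h x * ln (?h x))) \<partial>m) = (\<integral>\<^sup>+x. ennreal (- (g x * ln (g x))) \<partial>m)"
    using ae by (auto intro!: nn_integral_cong_AE)
  then show ?thesis
    using ex by (simp add: boltzmann_entropy_def Let_def)
qed

lemma boltzmann_entropy_restriction:
  assumes "prob_space m" and [measurable]: "S \<in> sets m" and c: "measure m S > 0"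
  shows "boltzmann_entropy m (density m (\<lambda>x. ennreal (indicator S x / measure m S))) =
    ereal (- ln (measure m S))"
proof -
  interpret prob_space m by fact
  define c where "c = measure m S"
  have "0 < c" "c \<le> 1" using c by (auto simp: c_def)
  let ?g = "\<lambda>x. indicator S x / c :: real"
  \<comment> \<open>The integrand is constant on \<open>S\<close> and vanishes off \<open>S\<close>
    because of the factor 0. As c \<le> 1, the constant is nonnegative, so there is no negative
    part.\<close>
  have g: "?g x * ln (?g x) = (- ln c / c) * indicator S x" for x
    using \<open>0 < c\<close> by (auto simp: indicator_def ln_div)
  have k: "0 \<le> - ln c / c"
    using \<open>0 < c\<close> \<open>c \<le> 1\<close> by (simp add: divide_nonpos_pos)
  have "(\<integral>\<^sup>+x. ennreal (?g x * ln (?g x)) \<partial>m) = (\<integral>\<^sup>+x. ennreal (- ln c / c) * indicator S x \<partial>m)"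
    unfolding g by (intro nn_integral_cong) (auto simp: indicator_def)
  also have "\<dots> = ennreal (- ln c / c) * ennreal c"
    by (simp add: nn_integral_cmult_indicator emeasure_eq_measure c_def)
  also have "\<dots> = ennreal (- ln c)"
    using k \<open>0 < c\<close> by (simp flip: ennreal_mult)
  finally have pos: "(\<integral>\<^sup>+x. ennreal (?g x * ln (?g x)) \<partial>m) = ennreal (- ln c)" .
  have neg: "ennreal (- (?g x * ln (?g x))) = 0" for x
    unfolding g using k by (intro ennreal_neg) (auto simp: indicator_def)
  have "boltzmann_entropy m (density m (\<lambda>x. ennreal (?g x))) =
      enn2ereal (ennreal (- ln c)) - enn2ereal 0"
    using \<open>0 < c\<close> by (subst boltzmann_entropy_density[OF sigma_finite_measure_axioms])
      (simp_all only: pos neg, simp_all)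
  also have "\<dots> = ereal (- ln c)"
    using \<open>0 < c\<close> \<open>c \<le> 1\<close> by (simp add: zero_ennreal.rep_eq)
  finally show ?thesis by (simp add: c_def)
qed

text \<open>The excess of \<rho> ln \<rho> over \<rho> - 1 is nonnegative, and its integral is the
  entropy because \<rho> and 1 have equal mass. If the entropy is nonpositive, the excess vanishes
  almost everywhere, which happens only where \<rho> = 1.\<close>

lemma boltzmann_entropy_nonpos_imp_eq:
  assumes "prob_space m" and [measurable]: "\<rho> \<in> borel_measurable m"
    and pos: "\<And>x. x \<in> space m \<Longrightarrow> 0 < (\<rho> x :: real)"
    and mass: "(\<integral>\<^sup>+x. ennreal (\<rho> x) \<partial>m) = 1"
    and le: "boltzmann_entropy m (density m (\<lambda>x. ennreal (\<rho> x))) \<le> 0"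
  shows "density m (\<lambda>x. ennreal (\<rho> x)) = m"
proof -
  interpret prob_space m by fact
  let ?h = "\<lambda>x. \<rho> x * ln (\<rho> x)"
  let ?P = "\<integral>\<^sup>+x. ennreal (?h x) \<partial>m" and ?N = "\<integral>\<^sup>+x. ennreal (- ?h x) \<partial>m"
  have lb: "?h x \<ge> \<rho> x - 1" "?h x = \<rho> x - 1 \<Longrightarrow> \<rho> x = 1" if "x \<in> space m" for x
  proof -
    \<comment> \<open>Multiplying ln y \<le> y - 1 at y = 1/\<rho> by \<rho> gives the lower bound
      together with its equality case.\<close>
    let ?y = "1 / \<rho> x"
    have y: "0 < ?y" using pos[OF that] by simp
    have eq: "?h x - (\<rho> x - 1) = \<rho> x * (?y - 1 - ln ?y)"
      using pos[OF that] by (simp add: ln_div field_simps)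
    have "ln ?y \<le> ?y - 1" by (rule ln_le_minus_one[OF y])
    then have "0 \<le> \<rho> x * (?y - 1 - ln ?y)"
      using pos[OF that] by (intro mult_nonneg_nonneg) auto
    with eq show "?h x \<ge> \<rho> x - 1" by linarith
    assume "?h x = \<rho> x - 1"
    with eq pos[OF that] have "ln ?y = ?y - 1" by auto
    then have "?y = 1" using ln_eq_minus_one[OF y] by simp
    then show "\<rho> x = 1" by simp
  qed
  \<comment> \<open>Since \<rho> ln \<rho> \<ge> \<rho> - 1 > -1, the negative part is at most 1.
    Its integral is therefore finite, and the sign of the entropy then bounds the positive part as
    well, giving integrability.\<close>
  have "?N \<le> (\<integral>\<^sup>+x. 1 \<partial>m)"
    using lb(1) pos by (intro nn_integral_mono) (fastforce simp: ennreal_le_1)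
  then have N: "?N < \<infinity>"
    by (simp add: emeasure_space_1 order_le_less_trans)
  have diff: "enn2ereal ?P - enn2ereal ?N \<le> 0"
    using le boltzmann_entropy_density[OF sigma_finite_measure_axioms, of \<rho>] pos
    by (simp add: less_imp_le)
  then have PN: "?P \<le> ?N"
    using N by (simp add: less_eq_ennreal.rep_eq ereal_minus_le_iff)
  then have P: "?P < \<infinity>" using N by (rule order_le_less_trans)
  have int_h: "integrable m ?h"
    using P N by (simp add: real_integrable_def less_top)
  have "(\<integral>x. ?h x \<partial>m) = enn2real ?P - enn2real ?N"
    by (rule real_lebesgue_integral_def[OF int_h])
  also have "\<dots> \<le> 0"
    using PN N by (simp add: enn2real_mono)
  finally have h0: "(\<integral>x. ?h x \<partial>m) \<le> 0" .
  have int_\<rho>: "integrable m \<rho>"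
    by (rule integrableI_nonneg) (use pos mass in \<open>auto intro: less_imp_le\<close>)
  have \<rho>1: "(\<integral>x. \<rho> x \<partial>m) = 1"
    using integral_eq_nn_integral[of \<rho> m] pos mass by (auto simp: less_imp_le)
  let ?k = "\<lambda>x. ?h x - (\<rho> x - 1)"
  have int_k: "integrable m ?k" using int_h int_\<rho> by simp
  have k0: "AE x in m. 0 \<le> ?k x" using lb(1) by auto
  have "(\<integral>x. ?k x \<partial>m) = (\<integral>x. ?h x \<partial>m)"
    using int_h int_\<rho> \<rho>1 by (simp add: prob_space)
  with h0 integral_nonneg_AE[OF k0] have "(\<integral>x. ?k x \<partial>m) = 0" by simp
  then have "AE x in m. ?k x = 0"
    using integral_nonneg_eq_0_iff_AE[OF int_k k0] by simp
  then have "AE x in m. \<rho> x = 1"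
    using AE_space by eventually_elim (use lb(2) in auto)
  then have "density m (\<lambda>x. ennreal (\<rho> x)) = density m (\<lambda>_. 1)"
    by (intro density_cong) auto
  then show ?thesis by (simp add: density_1)
qed

text \<open>The hypothesis \<open>min\<close> asks for minimality only among probability measures
  with bounded density relative to the candidate. No distance enters, yet such competitors suffice
  to force nonpositive entropy.\<close>

lemma entropy_minimizer_eq:
  assumes "prob_space m" and [measurable]: "\<rho> \<in> borel_measurable m"
    and pos: "\<And>x. x \<in> space m \<Longrightarrow> 0 < (\<rho> x :: real)"
    and mass: "(\<integral>\<^sup>+x. ennreal (\<rho> x) \<partial>m) = 1"
    and finite: "\<bar>boltzmann_entropy m (density m (\<lambda>x. ennreal (\<rho> x)))\<bar> \<noteq> \<infinity>"
    and min: "\<And>f C. f \<in> borel_measurable m \<Longrightarrow> (\<And>x. x \<in> space m \<Longrightarrow> f x \<le> ennreal C) \<Longrightarrow>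
      prob_space (density (density m (\<lambda>x. ennreal (\<rho> x))) f) \<Longrightarrow>
      boltzmann_entropy m (density m (\<lambda>x. ennreal (\<rho> x))) \<le>
      boltzmann_entropy m (density (density m (\<lambda>x. ennreal (\<rho> x))) f)"
  shows "density m (\<lambda>x. ennreal (\<rho> x)) = m"
proof -
  interpret prob_space m by fact
  obtain h where h: "boltzmann_entropy m (density m (\<lambda>x. ennreal (\<rho> x))) = ereal h"
    using finite by (cases "boltzmann_entropy m (density m (\<lambda>x. ennreal (\<rho> x)))") auto
  \<comment> \<open>Positivity of \<rho> makes these sets exhaust the space, while 1/\<rho> is
    bounded by n+1 on each of them.\<close>
  define S where "S n = {x \<in> space m. 1 / real (Suc n) \<le> \<rho> x}" for n
  have S[measurable]: "S n \<in> sets m" for n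
    unfolding S_def by measurable
  have "incseq S"
  proof (intro incseq_SucI subsetI)
    fix n x assume "x \<in> S n"
    moreover have "1 / real (Suc (Suc n)) \<le> 1 / real (Suc n)"
      by (intro divide_left_mono) auto
    ultimately show "x \<in> S (Suc n)"
      unfolding S_def by (auto intro: order_trans)
  qed
  moreover have "(\<Union>n. S n) = space m"
  proof -
    have "\<exists>n. 1 / real (Suc n) \<le> \<rho> x" if "x \<in> space m" for x
      using reals_Archimedean[OF pos[OF that]] by (auto simp: inverse_eq_divide intro: less_imp_le)
    then show ?thesis by (auto simp: S_def)
  qed
  moreover have "range S \<subseteq> sets m"
    using S by blast
  ultimately have lim: "(\<lambda>n. measure m (S n)) \<longlonglongrightarrow> 1"
    using finite_Lim_measure_incseq[of S] by (simp add: prob_space)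
  \<comment> \<open>Normalization requires positive mass, which holds for all large n since the
    masses tend to 1.\<close>
  have bound: "h \<le> - ln (measure m (S n))" if c: "0 < measure m (S n)" for n
  proof -
    let ?c = "measure m (S n)"
    \<comment> \<open>The factor 1/\<rho> cancels the density of the candidate, leaving the
      normalized restriction of \<open>m\<close> to \<open>S n\<close>.\<close>
    define f where "f x = ennreal (indicator (S n) x / (?c * \<rho> x))" for x
    have f[measurable]: "f \<in> borel_measurable m"
      unfolding f_def by measurable
    have f_le: "f x \<le> ennreal (real (Suc n) / ?c)" if "x \<in> space m" for x
    proof (cases "x \<in> S n")
      case True
      then have "1 / \<rho> x \<le> real (Suc n)"
        using pos[OF that] by (simp add: S_def field_simps)
      then have "1 / \<rho> x / ?c \<le> real (Suc n) / ?c"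
        using c by (intro divide_right_mono) auto
      then show ?thesis
        using True by (auto simp: f_def mult.commute intro!: ennreal_leI)
    qed (simp add: f_def)
    have "density (density m (\<lambda>x. ennreal (\<rho> x))) f = density m (\<lambda>x. ennreal (\<rho> x) * f x)"
      by (rule density_density_eq) auto
    also have "\<dots> = density m (\<lambda>x. ennreal (indicator (S n) x / ?c))"
    proof (intro density_cong AE_I2)
      fix x assume "x \<in> space m"
      then show "ennreal (\<rho> x) * f x = ennreal (indicator (S n) x / ?c)"
        using pos[of x] c by (simp add: f_def flip: ennreal_mult)
    qed auto
    finally have eq: "density (density m (\<lambda>x. ennreal (\<rho> x))) f =
      density m (\<lambda>x. ennreal (indicator (S n) x / ?c))" .
    have "(\<integral>\<^sup>+x. ennreal (indicator (S n) x / ?c) \<partial>m) =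
        (\<integral>\<^sup>+x. ennreal (1 / ?c) * indicator (S n) x \<partial>m)"
      by (intro nn_integral_cong) (auto simp: indicator_def)
    also have "\<dots> = ennreal (1 / ?c) * ennreal ?c"
      by (simp add: nn_integral_cmult_indicator emeasure_eq_measure)
    also have "\<dots> = 1"
      using c by (simp flip: ennreal_mult)
    finally have "prob_space (density m (\<lambda>x. ennreal (indicator (S n) x / ?c)))"
      by (intro prob_spaceI) (simp add: emeasure_density cong: nn_integral_cong)
    then have "ereal h \<le> boltzmann_entropy m (density m (\<lambda>x. ennreal (indicator (S n) x / ?c)))"
      using min[OF f f_le] unfolding h eq by simp
    then show ?thesis
      using boltzmann_entropy_restriction[OF prob_space_axioms S c] by simp
  qed
  have "(\<lambda>n. - ln (measure m (S n))) \<longlonglongrightarrow> - ln 1"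
    by (intro tendsto_intros lim) auto
  moreover have "eventually (\<lambda>n. h \<le> - ln (measure m (S n))) sequentially"
    using order_tendstoD(1)[OF lim zero_less_one] by eventually_elim (rule bound)
  ultimately have "h \<le> - ln 1"
    by (intro tendsto_lowerbound) auto
  then show ?thesis
    using h by (intro boltzmann_entropy_nonpos_imp_eq[OF assms(1-4)]) auto
qed

section \<open>Competitors in the Wasserstein space and the conclusion for manifolds\<close>

lemma wasserstein_space_density:
  assumes \<mu>: "\<mu> \<in> wasserstein_space A G"
    and f: "f \<in> borel_measurable \<mu>" "\<And>x. x \<in> space \<mu> \<Longrightarrow> f x \<le> ennreal C"
    and "prob_space (density \<mu> f)"
  shows "density \<mu> f \<in> wasserstein_space A G"
proof -
  \<comment> \<open>Applied with \<open>g\<close> the squared distance from each base point.\<close>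
  have "(\<integral>\<^sup>+p. g p \<partial>density \<mu> f) < \<infinity>" if "(\<integral>\<^sup>+p. g p \<partial>\<mu>) < \<infinity>" for g
  proof -
    have "(\<integral>\<^sup>+p. g p \<partial>density \<mu> f) \<le> ennreal C * (\<integral>\<^sup>+p. g p \<partial>\<mu>)"
      by (rule nn_integral_density_le[OF f])
    also have "\<dots> < \<infinity>"
      using that by (simp add: ennreal_mult_less_top)
    finally show ?thesis .
  qed
  then show ?thesis
    using assms by (auto simp: wasserstein_space_def)
qed

lemma optimal_plan_eq_weighted_measure:
  assumes "smooth_atlas A" and opt: "optimal_plan A G \<phi> \<mu>"
    and mass: "(\<integral>\<^sup>+p. 1 \<partial>\<mu>) = (\<integral>\<^sup>+p. 1 \<partial>weighted_measure A G \<phi>)"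
  shows "\<mu> = weighted_measure A G \<phi>"
proof -
  define m where "m = weighted_measure A G \<phi>"
  \<comment> \<open>The sigma-algebra generated by the Borel sets is the Borel one, whatever the
    volume function is.\<close>
  have sets_m[measurable_cong]: "sets m = sets borel"
    by (simp add: m_def weighted_measure_def riemannian_measure_def sets.sigma_sets_eq[of borel, simplified])
  obtain \<rho> where \<rho>: "smooth_fun A \<rho>" "\<And>p. 0 < \<rho> p" and \<mu>: "\<mu> = density m (\<lambda>p. ennreal (\<rho> p))"
    using opt by (auto simp: optimal_plan_def m_def)
  have W: "\<mu> \<in> wasserstein_space A G"
    and finite: "\<bar>boltzmann_entropy m \<mu>\<bar> \<noteq> \<infinity>"
    and min: "\<And>\<nu>. \<nu> \<in> wasserstein_space A G \<Longrightarrow> boltzmann_entropy m \<mu> \<le> boltzmann_entropy m \<nu>"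
    using opt by (auto simp: optimal_plan_def m_def)
  have [measurable]: "\<rho> \<in> borel_measurable m"
    using borel_measurable_continuous_onI[OF smooth_fun_continuous[OF assms(1) \<rho>(1)]]
    by (simp add: measurable_cong_sets[OF sets_m refl])
  interpret \<mu>: prob_space \<mu>
    using W by (simp add: wasserstein_space_def)
  have one: "(\<integral>\<^sup>+p. 1 \<partial>\<mu>) = 1"
    using \<mu>.emeasure_space_1 by simp
  \<comment> \<open>The normalization transfers the unit mass of the plan to
    \<open>m\<close>.\<close>
  with mass have "prob_space m"
    by (intro prob_spaceI) (simp add: m_def)
  moreover have "(\<integral>\<^sup>+p. ennreal (\<rho> p) \<partial>m) = 1"
    using one unfolding \<mu> by (subst (asm) nn_integral_density) auto
  moreover have "boltzmann_entropy m \<mu> \<le> boltzmann_entropy m (density \<mu> f)"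
    if "f \<in> borel_measurable m" "\<And>x. x \<in> space m \<Longrightarrow> f x \<le> ennreal C"
      "prob_space (density \<mu> f)" for f C
    using that by (intro min wasserstein_space_density[OF W, of f C]) (simp_all add: \<mu>)
  ultimately have "density m (\<lambda>p. ennreal (\<rho> p)) = m"
    using \<rho>(2) finite unfolding \<mu> by (intro entropy_minimizer_eq) auto
  then show ?thesis
    by (simp add: \<mu> m_def)
qed

theorem theorem5p6:
  fixes A :: "('a::{t2_space, second_countable_topology}, 'n::finite) chart set"
    and G :: "('a, 'n) metric_field"
    and \<phi> :: "'a \<Rightarrow> real"
  assumes "manifold_with_density A G \<phi>"
    and "complete_manifold A G"
    and "phi_parabolic A G \<phi>"
  shows "(\<forall>\<mu>. critical_plan A G \<phi> \<mu> \<longrightarrow>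
            (\<exists>\<alpha>::real. 0 < \<alpha> \<and> \<mu> = density (weighted_measure A G \<phi>) (\<lambda>_. ennreal \<alpha>))) \<and>
         (\<forall>\<mu>. optimal_plan A G \<phi> \<mu> \<and>
            (\<integral>\<^sup>+p. 1 \<partial>\<mu>) = (\<integral>\<^sup>+p. 1 \<partial>weighted_measure A G \<phi>) \<longrightarrow>
            \<mu> = density (riemannian_measure A G) (\<lambda>p. ennreal (exp (\<phi> p))))"
proof (intro conjI allI impI)
  fix \<mu> assume "critical_plan A G \<phi> \<mu>"
  then obtain \<rho> where \<rho>: "smooth_fun A \<rho>" "\<forall>p. 0 < \<rho> p" "\<forall>p. phi_laplacian A G \<phi> \<rho> p = 0"
    and \<mu>: "\<mu> = density (weighted_measure A G \<phi>) (\<lambda>p. ennreal (\<rho> p))"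
    by (auto simp: critical_plan_def)
  then obtain k where k: "\<forall>p. \<rho> p = k"
    using assms(3) unfolding phi_parabolic_def by (metis less_imp_le order_refl)
  \<comment> \<open>The constant is positive because it is the value of \<rho> at some
    point.\<close>
  with \<rho>(2) \<mu> show "\<exists>\<alpha>::real. 0 < \<alpha> \<and> \<mu> = density (weighted_measure A G \<phi>) (\<lambda>_. ennreal \<alpha>)"
    by (intro exI[of _ k]) auto
next
  fix \<mu>
  assume "optimal_plan A G \<phi> \<mu> \<and> (\<integral>\<^sup>+p. 1 \<partial>\<mu>) = (\<integral>\<^sup>+p. 1 \<partial>weighted_measure A G \<phi>)"
  moreover have "smooth_atlas A"
    using assms(1) by (simp add: manifold_with_density_def riemannian_manifold_def)
  ultimately show "\<mu> = density (riemannian_measure A G) (\<lambda>p. ennreal (exp (\<phi> p)))"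
    using optimal_plan_eq_weighted_measure by (metis weighted_measure_def)
qed

end
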